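(* Let $P$ be a (finite, propositional) normal logic program, and let $R^0, R^1, R^2, \ldots$ be any series of goal rewrite systems for $P$ in which $R^0$ is the goal rewrite system whose literal rewrite rules come from the completion $Comp(P)$ and, for each $i\ge 0$, $R^{i+1}$ is obtained from $R^i$ by replacing the rewrite rules of the literals in some set $\mathcal{L}_{\Delta_i}$ of literals by their computed rules generated on $R^i$ (computed rules being applied through the recycling rule). Then for every $i\ge 0$, $R^i$ is sound and complete with respect to the partial stable models of $P$, that is: (Soundness) for every literal $g$ and every rewrite sequence $g \rightarrow_{R^i} T(C_1)\vee\cdots\vee T(C_n)$, and for each $j\in\{1,\ldots,n\}$, there exists a partial stable model $M$ of $P$ such that $g\in C_j\subseteq M$; (Completeness) for every literal $g$ and every partial stable model $M$ of $P$ with $g\in M$, there is a rewrite sequence $g\rightarrow_{R^i} T(C_1)\vee\cdots\vee T(C_n)$ such that $g\in C_j\subseteq M$ for some $j\in\{1,\ldots,n\}$.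
   Context: **Programs.** Fix a propositional language $\mathcal{L}$ (a set of atoms). A rule has the form $a\leftarrow b_1,\ldots,b_m,\mathsf{not}\,c_1,\ldots,\mathsf{not}\,c_n$ with $a,b_i,c_i$ atoms; $\mathsf{not}\,c_i$ are called default negations. A (normal) program $P$ is a finite set of rules. A literal is an atom $\phi$ or its negation $\neg\phi$. The completion $Comp(P)$ contains, for each atom $\phi$, the equivalence $\phi\leftrightarrow F$ if $\phi$ is not the head of any rule, and otherwise $\phi\leftrightarrow B_1\vee\cdots\vee B_n$, where $\phi\leftarrow B_1,\ldots,\phi\leftarrow B_n$ are exactly the rules with head $\phi$, each $B_i$ being read as the conjunction of its body literals (with $\mathsf{not}\,c$ replaced by $\neg c$), and as $T$ if empty. **Partial stable models.** For a set $S$ of default negations let $F_P(S)=\{\mathsf{not}\,a : a \text{ an atom}, P\cup S\not\vdash a\}$, where $\vdash$ is propositional derivation treating each $\mathsf{not}\,\phi$ as a new named atom. A partial stable model $M$ is given by a set $S$ with $F_P(F_P(S))=S$ and $S\subseteq F_P(S)$, as follows: for each atom $\xi$, $\neg\xi\in M$ iff $\mathsf{not}\,\xi\in S$; $\xi\in M$ iff $P\cup S\vdash\xi$; otherwise $\xi$ is undefined (neither $\xi$ nor $\neg \xi$ is in $M$). **Goals and rewrite chains.** Goals are formulas built from literals, $F$ and expressions $T(C)$ ($C$ a set of literals, called a context) using $\wedge,\vee$; negation is pushed to the atoms by $\neg\neg\Phi\to\Phi$ and the De Morgan laws. When a literal $l$ is rewritten by its definition, every literal $l'$ in the resulting formula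 is a child of $l$, written $l\prec l'$. Thus each literal occurrence in a derived goal has a unique rewrite chain $g_1\prec g_2\prec\cdots\prec g_n$ from a literal $g_1$ of the initial goal to it; write $g_1\prec^+g_n$. Whenever rewriting the last literal of a chain produces $T$ (or $\neg F$), this is recorded as $T(C)$ with $C$ the set of literals on that chain; $\neg T$ is replaced by $F$. **Loops.** A chain $l_1\prec^+l_n$ is an odd loop if $l_1$ and $l_n$ are complementary. If $l_1=l_n$, it is a positive loop if all literals on the chain are atoms, a negative loop if all are negative literals, and an even loop otherwise. In all these cases $l_n$ is called a loop literal. **Rewrite rules of $R^0$.** - Program rules (literal rewriting): for $\phi\leftrightarrow B_1\vee\cdots\vee B_n$ in $Comp(P)$, rewrite $\phi$ to $B_1\vee\cdots\vee B_n$ and $\neg\phi$ to $\neg B_1\wedge\cdots\wedge\neg B_n$; applied only at non-loop literals. - Simplification rules: $F\vee\Phi\to\Phi$; $\Phi\vee F\to\Phi$; $F\wedge\Phi\to F$; $\Phi\wedge F\to F$; $T(C_1)\wedge T(C_2)\to T(C_1\cup C_2)$ if $C_1\cup C_2$ is consistent (contains no complementary pair of literals); $T(C_1)\wedge T(C_2)\to F$ if $C_1\cup C_2$ is inconsistent; $\Phi_1\wedge(\Phi_2\vee\Phi_3)\to(\Phi_1\wedge\Phi_2)\vee(\Phi_1\wedge\Phi_3)$; $(\Phi_1\vee\Phi_2)\wedge\Phi_3\to(\Phi_1\wedge\Phi_3)\vee(\Phi_2\wedge\Phi_3)$. - Loop rules, for a literal $g_n$ with rewrite chain $g_1\prec^+g_n$: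 $g_n\to F$ if for some $1\le i<n$, $g_i\prec^+g_n$ is a positive or odd loop; $g_n\to T(\{g_1,\ldots,g_n\})$ if for some $1\le i<n$, $g_i\prec^+g_n$ is a negative or even loop. A rewrite sequence in a system $R$ is a finite sequence of goals starting with an initial goal, each obtained from the previous one by one rule application; $g\rightarrow_R E$ denotes a rewrite sequence in $R$ from $g$ to $E$. Goal rewrite systems are terminating and confluent, and the normal form of a literal is $F$ or has the form $T(C_1)\vee\cdots\vee T(C_n)$. **Computed rules and recycling.** If a literal $p$ is rewritten in $R$ to its normal form $E$ (either $F$ or $T(C_1)\vee\cdots\vee T(C_n)$), the computed rule for $p$ generated on $R$ is $p\to E$. In a system where $p$ has a computed rule, that rule replaces the program rule (or earlier computed rule) for the literal $p$, and is used as follows at a non-loop literal $g_n=p$ with rewrite chain $g_1\prec^+g_n$. If the computed rule is $p\to F$, rewrite $g_n$ to $F$. If it is $g_n\to T(D_1)\vee\cdots\vee T(D_k)$, let $G=\{g_1,\ldots,g_n\}$ and let $D'_1,\ldots,D'_{k'}$ be those $D_i$ for which $D_i\cup G$ is consistent; the recycling rule rewrites $g_n\to T(G\cup D'_1)\vee\cdots\vee T(G\cup D'_{k'})$, where the empty disjunction is read as $F$. Loop literals are still handled by the loop rules. **The series $R^i$.** $R^0$ is the system above (no computed rules). For $i\ge 0$, let $\Delta_i$ be the set of computed rules generated on $R^i$ for the literals in a set $\mathcal{L}_{\Delta_i}$; $R^{i+1}$ is obtained from $R^i$ by replacing the rewrite rules for the literals in $\mathcal{L}_{\Delta_i}$ by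 those in $\Delta_i$. *)

theory Defs
  imports Main
begin

text \<open>
  The propositional language is the type \<open>'a\<close> of atoms, which may be infinite.
\<close>

datatype 'a lit = Pos 'a | Neg 'a

fun compl :: "'a lit \<Rightarrow> 'a lit" where
  "compl (Pos a) = Neg a"
| "compl (Neg a) = Pos a"

definition consistent :: "'a lit set \<Rightarrow> bool" where
  "consistent C \<longleftrightarrow> \<not> (\<exists>l\<in>C. compl l \<in> C)"

text \<open>
  \<open>Rule a [b\<^sub>1, \<dots>, b\<^sub>m] [c\<^sub>1, \<dots>, c\<^sub>n]\<close> stands for
  \<open>a \<leftarrow> b\<^sub>1, \<dots>, b\<^sub>m, not c\<^sub>1, \<dots>, not c\<^sub>n\<close>.
\<close>

datatype 'a rule = Rule (head: 'a) (pos_body: "'a list") (neg_body: "'a list")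

type_synonym 'a program = "'a rule set"


section \<open>Completion\<close>

datatype 'a form =
    FAtom 'a
  | FTrue
  | FFalse
  | FNot "'a form"
  | FAnd "'a form" "'a form"
  | FOr "'a form" "'a form"

fun conj_list :: "'a form list \<Rightarrow> 'a form" where
  "conj_list [] = FTrue"
| "conj_list [A] = A"
| "conj_list (A # B # As) = FAnd A (conj_list (B # As))"

fun disj_list :: "'a form list \<Rightarrow> 'a form" where
  "disj_list [] = FFalse"
| "disj_list [A] = A"
| "disj_list (A # B # As) = FOr A (disj_list (B # As))"

definition body_form :: "'a rule \<Rightarrow> 'a form" where
  "body_form r = conj_list (map FAtom (pos_body r) @ map (\<lambda>c. FNot (FAtom c)) (neg_body r))"

text \<open>
  \<open>completion P D\<close>: the equivalences \<open>\<phi> \<leftrightarrow> D \<phi>\<close> form \<open>Comp(P)\<close>. A program is a set, so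
  the order in which the bodies are listed in \<open>D \<phi>\<close> is arbitrary (but fixed by \<open>D\<close>).
\<close>

definition completion :: "'a program \<Rightarrow> ('a \<Rightarrow> 'a form) \<Rightarrow> bool" where
  "completion P D \<longleftrightarrow>
     (\<forall>\<phi>. \<exists>rs. distinct rs \<and> set rs = {r \<in> P. head r = \<phi>} \<and> D \<phi> = disj_list (map body_form rs))"


section \<open>Partial stable models\<close>

text \<open>Atoms of the language extended by a new named atom \<open>Naf a\<close> for each default negation \<open>not a\<close>.\<close>

datatype 'a natom = Atm 'a | Naf 'a

definition body_natoms :: "'a rule \<Rightarrow> 'a natom set" where
  "body_natoms r = Atm ` set (pos_body r) \<union> Naf ` set (neg_body r)"

inductive derivable :: "'a program \<Rightarrow> 'a natom set \<Rightarrow> 'a natom \<Rightarrow> bool"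
  for P :: "'a program" and S :: "'a natom set" where
  assm: "x \<in> S \<Longrightarrow> derivable P S x"
| rule: "r \<in> P \<Longrightarrow> (\<And>x. x \<in> body_natoms r \<Longrightarrow> derivable P S x) \<Longrightarrow> derivable P S (Atm (head r))"

definition F_op :: "'a program \<Rightarrow> 'a natom set \<Rightarrow> 'a natom set" where
  "F_op P S = {Naf a | a. \<not> derivable P S (Atm a)}"

definition partial_stable_model :: "'a program \<Rightarrow> 'a lit set \<Rightarrow> bool" where
  "partial_stable_model P M \<longleftrightarrow>
     (\<exists>S. S \<subseteq> range Naf \<and> F_op P (F_op P S) = S \<and> S \<subseteq> F_op P S \<and>
          M = {Neg \<xi> | \<xi>. Naf \<xi> \<in> S} \<union> {Pos \<xi> | \<xi>. derivable P S (Atm \<xi>)})"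


section \<open>Goals and rewrite chains\<close>

text \<open>
  Literal occurrences carry their rewrite chain: \<open>GLit [g\<^sub>1, \<dots>, g\<^sub>k] l\<close> is an occurrence of the
  literal \<open>l\<close> with rewrite chain \<open>g\<^sub>1 \<prec> \<dots> \<prec> g\<^sub>k \<prec> l\<close>. The initial goal consisting of a
  literal \<open>g\<close> is \<open>GLit [] g\<close>.
\<close>

datatype 'a goal =
    GLit "'a lit list" "'a lit"
  | GF
  | GT "'a lit set"
  | GAnd "'a goal" "'a goal"
  | GOr "'a goal" "'a goal"

text \<open>
  \<open>push True ch A\<close> and \<open>push False ch A\<close> are the goals replacing the last literal of the chain \<open>ch\<close>
  when that literal is rewritten to \<open>A\<close> and to \<open>\<not> A\<close>, respectively, with negations pushed to the
  atoms. A resulting \<open>T\<close> or \<open>\<not> F\<close> is recorded with the literals on \<open>ch\<close> as its context.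
\<close>

fun push :: "bool \<Rightarrow> 'a lit list \<Rightarrow> 'a form \<Rightarrow> 'a goal" where
  "push b ch (FAtom a) = GLit ch (if b then Pos a else Neg a)"
| "push b ch FTrue = (if b then GT (set ch) else GF)"
| "push b ch FFalse = (if b then GF else GT (set ch))"
| "push b ch (FNot A) = push (\<not> b) ch A"
| "push b ch (FAnd A B) =
     (if b then GAnd (push b ch A) (push b ch B) else GOr (push b ch A) (push b ch B))"
| "push b ch (FOr A B) =
     (if b then GOr (push b ch A) (push b ch B) else GAnd (push b ch A) (push b ch B))"

text \<open>
  \<open>T_disj Cs E\<close>: the goal \<open>E\<close> is \<open>T(C\<^sub>1) \<or> \<dots> \<or> T(C\<^sub>n)\<close>, \<open>n \<ge> 1\<close>, with \<open>Cs = [C\<^sub>1, \<dots>, C\<^sub>n]\<close>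
  and arbitrary bracketing.
\<close>

inductive T_disj :: "'a lit set list \<Rightarrow> 'a goal \<Rightarrow> bool" where
  "T_disj [C] (GT C)"
| "T_disj Cs E \<Longrightarrow> T_disj Ds E' \<Longrightarrow> T_disj (Cs @ Ds) (GOr E E')"

fun mk_T_disj :: "'a lit set list \<Rightarrow> 'a goal" where
  "mk_T_disj [] = GF"
| "mk_T_disj [C] = GT C"
| "mk_T_disj (C # D # Cs) = GOr (GT C) (mk_T_disj (D # Cs))"


section \<open>Loops\<close>

text \<open>These predicates concern a chain \<open>l\<^sub>1 \<prec>\<^sup>+ l\<^sub>n\<close>, so the length is at least 2.\<close>

definition odd_loop :: "'a lit list \<Rightarrow> bool" where
  "odd_loop ls \<longleftrightarrow> length ls \<ge> 2 \<and> last ls = compl (hd ls)"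

definition positive_loop :: "'a lit list \<Rightarrow> bool" where
  "positive_loop ls \<longleftrightarrow> length ls \<ge> 2 \<and> hd ls = last ls \<and> set ls \<subseteq> range Pos"

definition negative_loop :: "'a lit list \<Rightarrow> bool" where
  "negative_loop ls \<longleftrightarrow> length ls \<ge> 2 \<and> hd ls = last ls \<and> set ls \<subseteq> range Neg"

definition even_loop :: "'a lit list \<Rightarrow> bool" where
  "even_loop ls \<longleftrightarrow> length ls \<ge> 2 \<and> hd ls = last ls \<and> \<not> positive_loop ls \<and> \<not> negative_loop ls"

text \<open>
  For a literal \<open>g\<^sub>n\<close> with rewrite chain \<open>ch = [g\<^sub>1, \<dots>, g\<^sub>n]\<close>, the chains \<open>g\<^sub>i \<prec>\<^sup>+ g\<^sub>n\<close> with
  \<open>i < n\<close> are the suffixes \<open>drop k ch\<close> of length at least 2.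
\<close>

definition fail_loop_literal :: "'a lit list \<Rightarrow> bool" where
  "fail_loop_literal ch \<longleftrightarrow> (\<exists>k. positive_loop (drop k ch) \<or> odd_loop (drop k ch))"

definition success_loop_literal :: "'a lit list \<Rightarrow> bool" where
  "success_loop_literal ch \<longleftrightarrow> (\<exists>k. negative_loop (drop k ch) \<or> even_loop (drop k ch))"

definition loop_literal :: "'a lit list \<Rightarrow> bool" where
  "loop_literal ch \<longleftrightarrow> fail_loop_literal ch \<or> success_loop_literal ch"


section \<open>Goal rewrite systems\<close>

text \<open>
  A system assigns to every literal its current rewrite rule: \<open>Program A\<close> rewrites the literal to
  the formula \<open>A\<close>, and \<open>Computed E\<close> is a computed rule with right-hand side the goal \<open>E\<close>.
\<close>

datatype 'a lit_rule = Program "'a form" | Computed "'a goal"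

type_synonym 'a system = "'a lit \<Rightarrow> 'a lit_rule"

inductive step :: "'a system \<Rightarrow> 'a goal \<Rightarrow> 'a goal \<Rightarrow> bool" for R :: "'a system" where
  program:
    "R l = Program A \<Longrightarrow> ch = gs @ [l] \<Longrightarrow> \<not> loop_literal ch \<Longrightarrow>
     step R (GLit gs l) (push True ch A)"
| computed_F:
    "R l = Computed GF \<Longrightarrow> \<not> loop_literal (gs @ [l]) \<Longrightarrow> step R (GLit gs l) GF"
| recycling:
    "R l = Computed E \<Longrightarrow> T_disj Ds E \<Longrightarrow> ch = gs @ [l] \<Longrightarrow> \<not> loop_literal ch \<Longrightarrow>
     step R (GLit gs l)
       (mk_T_disj (map (\<lambda>D. set ch \<union> D) (filter (\<lambda>D. consistent (D \<union> set ch)) Ds)))"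
| loop_F:
    "fail_loop_literal (gs @ [l]) \<Longrightarrow> step R (GLit gs l) GF"
| loop_T:
    "ch = gs @ [l] \<Longrightarrow> success_loop_literal ch \<Longrightarrow> step R (GLit gs l) (GT (set ch))"
| F_or: "step R (GOr GF \<Phi>) \<Phi>"
| or_F: "step R (GOr \<Phi> GF) \<Phi>"
| F_and: "step R (GAnd GF \<Phi>) GF"
| and_F: "step R (GAnd \<Phi> GF) GF"
| T_and_T_consistent:
    "consistent (C\<^sub>1 \<union> C\<^sub>2) \<Longrightarrow> step R (GAnd (GT C\<^sub>1) (GT C\<^sub>2)) (GT (C\<^sub>1 \<union> C\<^sub>2))"
| T_and_T_inconsistent:
    "\<not> consistent (C\<^sub>1 \<union> C\<^sub>2) \<Longrightarrow> step R (GAnd (GT C\<^sub>1) (GT C\<^sub>2)) GF"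
| distrib_left:
    "step R (GAnd \<Phi>\<^sub>1 (GOr \<Phi>\<^sub>2 \<Phi>\<^sub>3)) (GOr (GAnd \<Phi>\<^sub>1 \<Phi>\<^sub>2) (GAnd \<Phi>\<^sub>1 \<Phi>\<^sub>3))"
| distrib_right:
    "step R (GAnd (GOr \<Phi>\<^sub>1 \<Phi>\<^sub>2) \<Phi>\<^sub>3) (GOr (GAnd \<Phi>\<^sub>1 \<Phi>\<^sub>3) (GAnd \<Phi>\<^sub>2 \<Phi>\<^sub>3))"
| in_and_left: "step R \<Phi> \<Phi>' \<Longrightarrow> step R (GAnd \<Phi> \<Psi>) (GAnd \<Phi>' \<Psi>)"
| in_and_right: "step R \<Psi> \<Psi>' \<Longrightarrow> step R (GAnd \<Phi> \<Psi>) (GAnd \<Phi> \<Psi>')"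
| in_or_left: "step R \<Phi> \<Phi>' \<Longrightarrow> step R (GOr \<Phi> \<Psi>) (GOr \<Phi>' \<Psi>)"
| in_or_right: "step R \<Psi> \<Psi>' \<Longrightarrow> step R (GOr \<Phi> \<Psi>) (GOr \<Phi> \<Psi>')"

definition rewrites_to :: "'a system \<Rightarrow> 'a lit \<Rightarrow> 'a goal \<Rightarrow> bool" where
  "rewrites_to R g E \<longleftrightarrow> (step R)\<^sup>*\<^sup>* (GLit [] g) E"

text \<open>
  Normal forms of a literal are unique only up to the order and bracketing of disjuncts; any of
  them may serve as the right-hand side of a computed rule.
\<close>

definition computed_rule :: "'a system \<Rightarrow> 'a lit \<Rightarrow> 'a goal \<Rightarrow> bool" where
  "computed_rule R p E \<longleftrightarrow> rewrites_to R p E \<and> (\<nexists>E'. step R E E')"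


section \<open>The series of systems\<close>

fun initial_system :: "('a \<Rightarrow> 'a form) \<Rightarrow> 'a system" where
  "initial_system D (Pos \<phi>) = Program (D \<phi>)"
| "initial_system D (Neg \<phi>) = Program (FNot (D \<phi>))"

definition recycled_system :: "'a system \<Rightarrow> 'a lit set \<Rightarrow> 'a system \<Rightarrow> bool" where
  "recycled_system R L R' \<longleftrightarrow>
     (\<forall>p. if p \<in> L then \<exists>E. computed_rule R p E \<and> R' p = Computed E else R' p = R p)"

text \<open>\<open>L i\<close> is the set of literals whose rules are replaced in passing from \<open>R i\<close> to \<open>R (Suc i)\<close>.\<close>

definition system_series ::
    "'a program \<Rightarrow> (nat \<Rightarrow> 'a lit set) \<Rightarrow> (nat \<Rightarrow> 'a system) \<Rightarrow> bool" where
  "system_series P L R \<longleftrightarrow>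
     (\<exists>D. completion P D \<and> R 0 = initial_system D) \<and>
     (\<forall>i. recycled_system (R i) (L i) (R (Suc i)))"

definition sound :: "'a program \<Rightarrow> 'a system \<Rightarrow> bool" where
  "sound P R \<longleftrightarrow>
     (\<forall>g E Cs. rewrites_to R g E \<and> T_disj Cs E \<longrightarrow>
        (\<forall>j<length Cs. \<exists>M. partial_stable_model P M \<and> g \<in> Cs ! j \<and> Cs ! j \<subseteq> M))"

definition complete :: "'a program \<Rightarrow> 'a system \<Rightarrow> bool" where
  "complete P R \<longleftrightarrow>
     (\<forall>g M. partial_stable_model P M \<and> g \<in> M \<longrightarrow>
        (\<exists>E Cs. rewrites_to R g E \<and> T_disj Cs E \<and> (\<exists>j<length Cs. g \<in> Cs ! j \<and> Cs ! j \<subseteq> M)))"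

end

theory Submission imports Defs begin

text \<open>
  Call a set of literals admissible if it is consistent, each of its literals is supported in it by
  the program, and its atoms are derivable from its default negations. Such a set extends to a
  partial stable model by a fixpoint of \<open>F\<^sup>2\<close>. A context of the normal form of a literal is
  the union of the chains of a proof tree and of the contexts recycled at its leaves; it is
  admissible if the recycled ones are, since every positive cycle of the tree is cut by a negative
  literal. Conversely, given a partial stable model \<open>M\<close>, always expanding an atom of \<open>M\<close> by a
  rule whose positive body has smaller derivation rank keeps a goal true in \<open>M\<close>: chains inside
  \<open>M\<close> then run into no odd or positive loop, and each recycled literal has a context inside \<open>M\<close>.
  Both properties pass to the computed rules, hence to all systems of the series by induction.
\<close>

section \<open>Partial stable models\<close>

lemma compl_compl [simp]: "compl (compl l) = l"
  by (cases l) auto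

lemma consistent_mono: "consistent D \<Longrightarrow> C \<subseteq> D \<Longrightarrow> consistent C"
  unfolding consistent_def by blast

lemma derivable_cut:
  assumes "derivable P S x" and "\<And>y. y \<in> S \<Longrightarrow> derivable P S' y"
  shows "derivable P S' x"
  using assms(1) by induction (auto intro: assms(2) derivable.rule)

lemma derivable_mono: "derivable P S x \<Longrightarrow> S \<subseteq> S' \<Longrightarrow> derivable P S' x"
  by (blast intro: derivable_cut derivable.assm)

lemma derivable_Naf_iff: "derivable P S (Naf a) \<longleftrightarrow> Naf a \<in> S"
  by (auto intro: derivable.assm elim: derivable.cases)

lemma F_op_antimono: "S \<subseteq> S' \<Longrightarrow> F_op P S' \<subseteq> F_op P S"
  unfolding F_op_def using derivable_mono by blast

lemma mono_F_op_F_op: "mono (\<lambda>S. F_op P (F_op P S))"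
  by (intro monoI F_op_antimono)

text \<open>
  The least fixpoint of \<open>F\<^sup>2\<close> above \<open>S\<close> and the greatest one below \<open>F S\<close> are exchanged by \<open>F\<close>.
\<close>

lemma F_op_fixpoint_above:
  assumes "S \<subseteq> F_op P S" and "S \<subseteq> F_op P (F_op P S)"
  shows "\<exists>S'. S \<subseteq> S' \<and> F_op P (F_op P S') = S' \<and> S' \<subseteq> F_op P S'"
proof -
  let ?F = "F_op P"
  \<comment> \<open>The extra \<open>S\<close> and \<open>?F S\<close> impose the bounds. Since
    \<open>S\<close> is contained in \<open>?F (?F S)\<close>, both \<open>X\<close> and
    \<open>Y\<close> turn out to be fixpoints of the double operator itself.\<close>
  define f where "f X = S \<union> ?F (?F X)" for X
  define h where "h X = ?F S \<inter> ?F (?F X)" for X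
  note F2_mono = monoD[OF mono_F_op_F_op[of P]]
  have f: "mono f" and h: "mono h"
    unfolding f_def h_def using F2_mono by (intro monoI; blast)+
  define X where "X = lfp f"
  define Y where "Y = gfp h"
  have X: "X = S \<union> ?F (?F X)" and Y: "Y = ?F S \<inter> ?F (?F Y)"
    using lfp_unfold[OF f] gfp_unfold[OF h] by (simp_all add: X_def Y_def f_def h_def)
  have "?F (?F S) \<subseteq> ?F (?F X)" using X by (intro F2_mono) blast
  then have fixX: "?F (?F X) = X" using X assms(2) by blast
  have "?F (?F Y) \<subseteq> ?F (?F (?F S))" using Y by (intro F2_mono) blast
  also have "\<dots> \<subseteq> ?F S" by (intro F_op_antimono assms(2))
  finally have fixY: "?F (?F Y) = Y" using Y by blast
  have leX: "X \<subseteq> Z" if "S \<subseteq> Z" "?F (?F Z) = Z" for Z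
    unfolding X_def by (rule lfp_lowerbound) (use that in \<open>simp add: f_def\<close>)
  have geY: "Z \<subseteq> Y" if "Z \<subseteq> ?F S" "Z \<subseteq> ?F (?F Z)" for Z
    unfolding Y_def by (rule gfp_upperbound) (use that in \<open>simp add: h_def\<close>)
  have SX: "S \<subseteq> X" and YS: "Y \<subseteq> ?F S" using X Y by blast+
  have "S \<subseteq> ?F Y" using assms(2) F_op_antimono[OF YS, of P] by blast
  \<comment> \<open>\<open>?F Y\<close> is again a fixpoint of the double operator above
    \<open>S\<close>, so minimality of \<open>X\<close> applies. Applying \<open>F_op\<close> once
    more gives \<open>Y \<subseteq> ?F X\<close>, and \<open>X \<subseteq> Y\<close> then closes the
    chain.\<close>
  then have "X \<subseteq> ?F Y" by (rule leX) (simp add: fixY)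
  then have "Y \<subseteq> ?F X" using F_op_antimono[of X "?F Y" P] fixY by simp
  moreover have "S \<subseteq> Y" using assms by (rule geY)
  then have "X \<subseteq> Y" using fixY by (rule leX)
  ultimately show ?thesis using SX fixX by blast
qed

section \<open>Admissible sets of literals\<close>

definition body_lits :: "'a rule \<Rightarrow> 'a lit set" where
  "body_lits r = Pos ` set (pos_body r) \<union> Neg ` set (neg_body r)"

text \<open>Falsity of a body is witnessed by a complement in \<open>K\<close>, not by absence from
  \<open>K\<close>. This suits partial interpretations and makes both cases monotone in
  \<open>K\<close>.\<close>

fun supported :: "'a program \<Rightarrow> 'a lit \<Rightarrow> 'a lit set \<Rightarrow> bool" where
  "supported P (Pos a) K \<longleftrightarrow> (\<exists>r\<in>P. head r = a \<and> body_lits r \<subseteq> K)"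
| "supported P (Neg a) K \<longleftrightarrow> (\<forall>r\<in>P. head r = a \<longrightarrow> (\<exists>l\<in>body_lits r. compl l \<in> K))"

lemma supported_mono: "supported P l K \<Longrightarrow> K \<subseteq> K' \<Longrightarrow> supported P l K'"
  by (cases l; simp) blast+

definition nafs :: "'a lit set \<Rightarrow> 'a natom set" where
  "nafs C = {Naf a | a. Neg a \<in> C}"

lemma Naf_in_nafs [simp]: "Naf a \<in> nafs C \<longleftrightarrow> Neg a \<in> C"
  by (simp add: nafs_def)

lemma nafs_mono: "C \<subseteq> D \<Longrightarrow> nafs C \<subseteq> nafs D"
  by (auto simp: nafs_def)

lemma Atm_notin_nafs [simp]: "Atm a \<notin> nafs C"
  by (simp add: nafs_def)

text \<open>Support alone would accept an atom supported by itself through a positive cycle; the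
  derivability clause excludes this. Circular support of negative literals remains allowed.\<close>

definition admissible :: "'a program \<Rightarrow> 'a lit set \<Rightarrow> bool" where
  "admissible P C \<longleftrightarrow> consistent C \<and> (\<forall>l\<in>C. supported P l C) \<and>
     (\<forall>a. Pos a \<in> C \<longrightarrow> derivable P (nafs C) (Atm a))"

text \<open>The atoms negated in \<open>C\<close> form an unfounded set. Any rule for one of them
  has a body literal with complement in \<open>C\<close>: a positive one is blocked by the induction
  hypothesis, a negative one by the absence of its default negation from \<open>S\<close>.\<close>

lemma unfounded_not_derivable:
  assumes "derivable P S x"
    and "\<And>a. Neg a \<in> C \<Longrightarrow> supported P (Neg a) C"
    and "\<And>a. Atm a \<notin> S"
    and "\<And>a. Pos a \<in> C \<Longrightarrow> Naf a \<notin> S"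
  shows "x = Atm a \<Longrightarrow> Neg a \<notin> C"
  using assms(1)
proof (induction arbitrary: a)
  case (assm x)
  then show ?case using assms(3) by auto
next
  case (rule r)
  show ?case
  proof
    assume "Neg a \<in> C"
    then obtain l where l: "l \<in> body_lits r" "compl l \<in> C"
      using assms(2)[of a] rule by auto
    show False
    proof (cases l)
      case (Pos b)
      then have "Atm b \<in> body_natoms r" using l by (auto simp: body_lits_def body_natoms_def)
      then show False using rule.IH l Pos by auto
    next
      case (Neg b)
      then have "Naf b \<in> body_natoms r" using l by (auto simp: body_lits_def body_natoms_def)
      then have "Naf b \<in> S" using rule.hyps(2) derivable_Naf_iff[of P S b] by simp
      then show False using assms(4) l Neg by auto
    qed
  qed
qed

lemma admissible_extends_to_partial_stable_model:
  assumes "admissible P C"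
  shows "\<exists>M. partial_stable_model P M \<and> C \<subseteq> M"
proof -
  have cons: "Pos a \<in> C \<Longrightarrow> Neg a \<notin> C" for a
    using assms unfolding admissible_def consistent_def by force
  have supp: "supported P (Neg a) C" if "Neg a \<in> C" for a
    using assms that by (auto simp: admissible_def)
  have der: "derivable P (nafs C) (Atm a)" if "Pos a \<in> C" for a
    using assms that by (auto simp: admissible_def)
  have closed: "nafs C \<subseteq> F_op P S"
    if S: "\<And>a. Atm a \<notin> S" "\<And>a. Pos a \<in> C \<Longrightarrow> Naf a \<notin> S" for S
  proof -
    have "Neg a \<notin> C" if "derivable P S (Atm a)" for a
      by (rule unfounded_not_derivable[OF that _ _ _ refl]) (fact supp S)+
    then show ?thesis by (auto simp: F_op_def nafs_def)
  qed
  \<comment> \<open>Both inclusions are instances of \<open>closed\<close>: its second premise is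
    consistency of \<open>C\<close> here, and derivability of the atoms of \<open>C\<close> for
    \<open>F_op P (nafs C)\<close>.\<close>
  have "nafs C \<subseteq> F_op P (nafs C)"
    by (rule closed) (simp_all add: cons)
  moreover have "nafs C \<subseteq> F_op P (F_op P (nafs C))"
    by (rule closed) (use der in \<open>auto simp: F_op_def\<close>)
  ultimately obtain S where S: "nafs C \<subseteq> S" "F_op P (F_op P S) = S" "S \<subseteq> F_op P S"
    using F_op_fixpoint_above[of "nafs C" P] by metis
  define M where "M = {Neg \<xi> | \<xi>. Naf \<xi> \<in> S} \<union> {Pos \<xi> | \<xi>. derivable P S (Atm \<xi>)}"
  have "S \<subseteq> range Naf" using S(2) by (auto simp: F_op_def)
  then have "partial_stable_model P M"
    unfolding partial_stable_model_def M_def by (intro exI[of _ S] conjI S refl)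
  moreover have "C \<subseteq> M"
  proof
    fix l assume "l \<in> C"
    then show "l \<in> M"
      using S(1) derivable_mono[OF der S(1)] by (cases l) (auto simp: M_def)
  qed
  ultimately show ?thesis by blast
qed

section \<open>Derivation stages and ranks\<close>

primrec stage :: "'a program \<Rightarrow> 'a natom set \<Rightarrow> nat \<Rightarrow> 'a natom set" where
  "stage P S 0 = S"
| "stage P S (Suc n) = S \<union> {Atm (head r) | r. r \<in> P \<and> body_natoms r \<subseteq> stage P S n}"

lemma stage_mono: "m \<le> n \<Longrightarrow> stage P S m \<subseteq> stage P S n"
proof (rule lift_Suc_mono_le[of "stage P S"])
  show "stage P S n \<subseteq> stage P S (Suc n)" for n
    by (induction n) auto
qed

lemma stage_derivable: "x \<in> stage P S n \<Longrightarrow> derivable P S x"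
  by (induction n arbitrary: x) (auto intro: derivable.intros)

text \<open>Rule bodies are finite, so the stages of the body elements have a maximum and finite
  stages exhaust the derivable elements.\<close>

lemma derivable_stage: "derivable P S x \<Longrightarrow> \<exists>n. x \<in> stage P S n"
proof (induction rule: derivable.induct)
  case (assm x)
  then show ?case by (metis stage.simps(1))
next
  case (rule r)
  then obtain f where f: "\<And>x. x \<in> body_natoms r \<Longrightarrow> x \<in> stage P S (f x)" by metis
  have fin: "finite (body_natoms r)" by (simp add: body_natoms_def)
  have "x \<in> stage P S (Max (f ` body_natoms r))" if "x \<in> body_natoms r" for x
    using f[OF that] stage_mono[of "f x" "Max (f ` body_natoms r)" P S] fin that by auto
  then have "Atm (head r) \<in> stage P S (Suc (Max (f ` body_natoms r)))"
    using rule.hyps(1) by auto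
  then show ?case by blast
qed

lemma partial_stable_model_consistent:
  assumes "partial_stable_model P M"
  shows "consistent M"
proof -
  have "\<not> (Pos a \<in> M \<and> Neg a \<in> M)" for a
    using assms by (auto simp: partial_stable_model_def F_op_def)
  then show ?thesis unfolding consistent_def by (metis compl.simps lit.exhaust)
qed

text \<open>As \<open>S\<close> equals \<open>F_op P (F_op P S)\<close>, falsity in \<open>M\<close>
  is underivability from \<open>F_op P S\<close>. Hence each rule for \<open>a\<close> has a body
  element underivable from there, and this yields a body literal with complement in
  \<open>M\<close>.\<close>

lemma partial_stable_model_Neg_supported:
  assumes "partial_stable_model P M" "Neg a \<in> M"
  shows "supported P (Neg a) M"
proof -
  from assms(1) obtain S where S: "F_op P (F_op P S) = S"
    and M: "M = {Neg \<xi> | \<xi>. Naf \<xi> \<in> S} \<union> {Pos \<xi> | \<xi>. derivable P S (Atm \<xi>)}"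
    unfolding partial_stable_model_def by blast
  have NegM: "Neg b \<in> M \<longleftrightarrow> \<not> derivable P (F_op P S) (Atm b)" for b
    using S unfolding M by (auto simp: F_op_def)
  show ?thesis
  proof (simp, intro ballI impI)
    fix r assume r: "r \<in> P" "head r = a"
    have "\<exists>x\<in>body_natoms r. \<not> derivable P (F_op P S) x"
      using NegM[of a] assms(2) r derivable.rule[of r P "F_op P S"] by blast
    then consider b where "b \<in> set (pos_body r)" "Neg b \<in> M"
      | c where "c \<in> set (neg_body r)" "Naf c \<notin> F_op P S"
      by (auto simp: body_natoms_def NegM derivable_Naf_iff)
    then show "\<exists>l\<in>body_lits r. compl l \<in> M"
    proof cases
      case 1
      then show ?thesis by (intro bexI[of _ "Pos b"]) (auto simp: body_lits_def)
    next
      case 2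
      then show ?thesis
        by (intro bexI[of _ "Neg c"]) (auto simp: body_lits_def M F_op_def)
    qed
  qed
qed

text \<open>\<open>rk a\<close> is the first stage containing \<open>a\<close>. It is not 0, because
  \<open>S\<close> contains only default negations, so the rule entering \<open>a\<close> has its
  whole body in the preceding stage.\<close>

lemma partial_stable_model_ranked:
  assumes "partial_stable_model P M"
  obtains rk :: "'a \<Rightarrow> nat" where
    "\<And>a. Pos a \<in> M \<Longrightarrow>
       \<exists>r\<in>P. head r = a \<and> body_lits r \<subseteq> M \<and> (\<forall>b\<in>set (pos_body r). rk b < rk a)"
proof -
  from assms obtain S where SN: "S \<subseteq> range Naf"
    and M: "M = {Neg \<xi> | \<xi>. Naf \<xi> \<in> S} \<union> {Pos \<xi> | \<xi>. derivable P S (Atm \<xi>)}"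
    unfolding partial_stable_model_def by blast
  define rk where "rk a = (LEAST n. Atm a \<in> stage P S n)" for a
  have "\<exists>r\<in>P. head r = a \<and> body_lits r \<subseteq> M \<and> (\<forall>b\<in>set (pos_body r). rk b < rk a)"
    if "Pos a \<in> M" for a
  proof -
    have "\<exists>n. Atm a \<in> stage P S n" using that by (auto simp: M intro: derivable_stage)
    then have a: "Atm a \<in> stage P S (rk a)" unfolding rk_def by (rule LeastI_ex)
    have "Atm a \<notin> S" using SN by auto
    with a obtain n r where n: "rk a = Suc n" and r: "r \<in> P" "head r = a" "body_natoms r \<subseteq> stage P S n"
      by (cases "rk a") auto
    have "rk b < rk a" if "b \<in> set (pos_body r)" for b
    proof -
      have "Atm b \<in> stage P S n" using r(3) that by (auto simp: body_natoms_def)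
      then have "rk b \<le> n" unfolding rk_def by (rule Least_le)
      then show ?thesis using n by simp
    qed
    moreover have "body_lits r \<subseteq> M"
    proof -
      have *: "derivable P S x" if "x \<in> body_natoms r" for x
        using stage_derivable[OF subsetD[OF r(3) that]] .
      show ?thesis
      proof
        fix l assume "l \<in> body_lits r"
        then show "l \<in> M"
          using *[of "Atm a" for a] *[of "Naf a" for a]
          by (cases l) (auto simp: body_lits_def body_natoms_def M derivable_Naf_iff)
      qed
    qed
    ultimately show ?thesis using r by blast
  qed
  then show ?thesis by (rule that)
qed


section \<open>Loops\<close>

text \<open>Turns the quantification over suffixes in the loop predicates into membership among the
  earlier literals of the chain.\<close>

lemma ex_drop_snoc_iff:
  "(\<exists>k. length (drop k (gs @ [l])) \<ge> 2 \<and> hd (drop k (gs @ [l])) = m) \<longleftrightarrow> m \<in> set gs"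
proof
  assume "\<exists>k. length (drop k (gs @ [l])) \<ge> 2 \<and> hd (drop k (gs @ [l])) = m"
  then obtain k where k: "length (drop k (gs @ [l])) \<ge> 2" "hd (drop k (gs @ [l])) = m" by blast
  then have "k < length gs" by auto
  then have "gs ! k = m" using k by (simp add: hd_drop_conv_nth nth_append)
  then show "m \<in> set gs" using \<open>k < length gs\<close> by auto
next
  assume "m \<in> set gs"
  then obtain k where "k < length gs" "gs ! k = m" by (auto simp: in_set_conv_nth)
  then show "\<exists>k. length (drop k (gs @ [l])) \<ge> 2 \<and> hd (drop k (gs @ [l])) = m"
    by (intro exI[of _ k]) (auto simp: hd_drop_conv_nth nth_append)
qed

lemma last_drop_snoc: "length (drop k (gs @ [l])) \<ge> 2 \<Longrightarrow> last (drop k (gs @ [l])) = l"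
  by (simp add: last_drop)

lemma success_loop_literal_mem: "success_loop_literal (gs @ [l]) \<Longrightarrow> l \<in> set gs"
  unfolding success_loop_literal_def negative_loop_def even_loop_def
  using ex_drop_snoc_iff[of gs l l] last_drop_snoc[of _ gs l] by metis

text \<open>Positive, negative and even loops together cover every repetition, and odd loops cover
  every complementary pair.\<close>

lemma loop_literal_snoc_iff: "loop_literal (gs @ [l]) \<longleftrightarrow> l \<in> set gs \<or> compl l \<in> set gs"
proof -
  let ?D = "\<lambda>k. drop k (gs @ [l])"
  have "loop_literal (gs @ [l]) \<longleftrightarrow>
      (\<exists>k. length (?D k) \<ge> 2 \<and> hd (?D k) = last (?D k)) \<or>
      (\<exists>k. length (?D k) \<ge> 2 \<and> last (?D k) = compl (hd (?D k)))"
    unfolding loop_literal_def fail_loop_literal_def success_loop_literal_def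
      negative_loop_def even_loop_def positive_loop_def odd_loop_def by blast
  also have "\<dots> \<longleftrightarrow> (\<exists>k. length (?D k) \<ge> 2 \<and> hd (?D k) = l) \<or>
      (\<exists>k. length (?D k) \<ge> 2 \<and> hd (?D k) = compl l)"
    using last_drop_snoc[of _ gs l] by (metis compl_compl)
  finally show ?thesis by (simp only: ex_drop_snoc_iff)
qed

text \<open>The atoms occurring before the last negative literal of the chain. Appending an atom
  adds none, so the set does not grow while a chain descends through atoms.\<close>

definition pos_before_neg :: "'a lit list \<Rightarrow> 'a set" where
  "pos_before_neg gs = {a. \<exists>us b vs. gs = us @ Neg b # vs \<and> Pos a \<in> set us}"

lemma pos_before_neg_subset: "a \<in> pos_before_neg gs \<Longrightarrow> Pos a \<in> set gs"
  by (auto simp: pos_before_neg_def)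

lemma pos_before_neg_snoc_Pos: "pos_before_neg (gs @ [Pos a]) \<subseteq> pos_before_neg gs"
proof
  fix c assume "c \<in> pos_before_neg (gs @ [Pos a])"
  then obtain us b vs where eq: "gs @ [Pos a] = us @ Neg b # vs" and c: "Pos c \<in> set us"
    by (auto simp: pos_before_neg_def)
  from eq have "gs = us @ Neg b # butlast vs"
    by (cases vs rule: rev_cases) auto
  then show "c \<in> pos_before_neg gs" using c by (auto simp: pos_before_neg_def)
qed

text \<open>A loop ending in an atom is not negative, so it is even and has a negative literal
  between the two occurrences of \<open>Pos a\<close>.\<close>

lemma success_loop_literal_Pos:
  assumes "success_loop_literal (gs @ [Pos a])"
  shows "a \<in> pos_before_neg gs"
proof -
  from assms obtain k where
    k: "negative_loop (drop k (gs @ [Pos a])) \<or> even_loop (drop k (gs @ [Pos a]))"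
    by (auto simp: success_loop_literal_def)
  define ls where "ls = drop k (gs @ [Pos a])"
  have ls: "length ls \<ge> 2" "hd ls = last ls" "\<not> set ls \<subseteq> range Pos"
  proof -
    have "\<not> set ls \<subseteq> range Pos" if "set ls \<subseteq> range Neg" "length ls \<ge> 2"
      using that by (cases ls) auto
    then show "length ls \<ge> 2" "hd ls = last ls" "\<not> set ls \<subseteq> range Pos"
      using k unfolding ls_def[symmetric] negative_loop_def even_loop_def positive_loop_def by blast+
  qed
  have "last ls = Pos a" using ls(1) unfolding ls_def by (rule last_drop_snoc)
  then have "hd ls = Pos a" "ls \<noteq> []" using ls(1,2) by auto
  then obtain zs where zs: "ls = Pos a # zs" by (metis list.collapse)
  from ls(3) obtain m where m: "m \<in> set ls" "m \<notin> range Pos" by blast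
  then obtain b where "m = Neg b" by (metis lit.exhaust rangeI)
  with m zs have "Neg b \<in> set zs" by auto
  then obtain xs ys where "zs = xs @ Neg b # ys" by (auto simp: in_set_conv_decomp)
  then have "gs @ [Pos a] = (take k (gs @ [Pos a]) @ Pos a # xs) @ Neg b # ys"
    using zs unfolding ls_def by (metis append.assoc append_Cons append_take_drop_id)
  moreover have "Pos a \<in> set (take k (gs @ [Pos a]) @ Pos a # xs)" by simp
  ultimately have "a \<in> pos_before_neg (gs @ [Pos a])"
    unfolding pos_before_neg_def by (intro CollectI exI conjI)
  then show ?thesis using pos_before_neg_snoc_Pos[of gs a] by blast
qed


section \<open>Completion\<close>

text \<open>Truth (\<open>b\<close> true) and falsity (\<open>b\<close> false) in the style of
  Kleene's strong three-valued logic, with the same recursion as \<open>push\<close>.\<close>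

fun holds :: "bool \<Rightarrow> 'a lit set \<Rightarrow> 'a form \<Rightarrow> bool" where
  "holds b K (FAtom a) \<longleftrightarrow> (if b then Pos a else Neg a) \<in> K"
| "holds b K FTrue \<longleftrightarrow> b"
| "holds b K FFalse \<longleftrightarrow> \<not> b"
| "holds b K (FNot A) \<longleftrightarrow> holds (\<not> b) K A"
| "holds b K (FAnd A B) \<longleftrightarrow> (if b then holds b K A \<and> holds b K B else holds b K A \<or> holds b K B)"
| "holds b K (FOr A B) \<longleftrightarrow> (if b then holds b K A \<or> holds b K B else holds b K A \<and> holds b K B)"

lemma holds_conj_list:
  "holds b K (conj_list As) \<longleftrightarrow>
     (if b then \<forall>A\<in>set As. holds b K A else \<exists>A\<in>set As. holds b K A)"
  by (induction As rule: conj_list.induct) auto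

lemma holds_disj_list:
  "holds b K (disj_list As) \<longleftrightarrow>
     (if b then \<exists>A\<in>set As. holds b K A else \<forall>A\<in>set As. holds b K A)"
  by (induction As rule: disj_list.induct) auto

lemma set_form_conj_list: "set_form (conj_list As) = (\<Union>A\<in>set As. set_form A)"
  by (induction As rule: conj_list.induct) auto

lemma set_form_disj_list: "set_form (disj_list As) = (\<Union>A\<in>set As. set_form A)"
  by (induction As rule: disj_list.induct) auto

lemma holds_body_form:
  "holds True K (body_form r) \<longleftrightarrow> body_lits r \<subseteq> K"
  "holds False K (body_form r) \<longleftrightarrow> (\<exists>l\<in>body_lits r. compl l \<in> K)"
  by (force simp: body_form_def holds_conj_list body_lits_def)+

definition atoms :: "'a program \<Rightarrow> 'a set" where
  "atoms P = (\<Union>r\<in>P. set (pos_body r) \<union> set (neg_body r))"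

lemma finite_atoms: "finite P \<Longrightarrow> finite (atoms P)"
  by (simp add: atoms_def)

text \<open>Abstracts from the listing order of the bodies. The first conjunct bounds the children,
  for normalization; the second is the meaning used for soundness and completeness.\<close>

definition defining :: "'a program \<Rightarrow> 'a lit \<Rightarrow> 'a form \<Rightarrow> bool" where
  "defining P l A \<longleftrightarrow> set_form A \<subseteq> atoms P \<and> (\<forall>K. holds True K A \<longleftrightarrow> supported P l K)"

lemma initial_system_defining:
  assumes "completion P D"
  obtains A where "initial_system D l = Program A" and "defining P l A"
proof -
  define \<phi> where "\<phi> = (case l of Pos a \<Rightarrow> a | Neg a \<Rightarrow> a)"
  obtain rs where rs: "set rs = {r \<in> P. head r = \<phi>}" "D \<phi> = disj_list (map body_form rs)"
    using assms unfolding completion_def by blast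
  have "set_form (D \<phi>) \<subseteq> atoms P"
    by (auto simp: rs body_form_def set_form_disj_list set_form_conj_list atoms_def)
  moreover have "holds True K (D \<phi>) \<longleftrightarrow> supported P (Pos \<phi>) K"
    "holds False K (D \<phi>) \<longleftrightarrow> supported P (Neg \<phi>) K" for K
    by (auto simp: rs holds_disj_list holds_body_form)
  ultimately show ?thesis
    by (cases l) (auto simp: \<phi>_def defining_def intro!: that)
qed


section \<open>Normal forms\<close>

definition normal_goal :: "'a goal \<Rightarrow> bool" where
  "normal_goal E \<longleftrightarrow> E = GF \<or> (\<exists>Cs. T_disj Cs E)"

lemma normal_GF [simp]: "normal_goal GF"
  by (simp add: normal_goal_def)

lemma normal_GT [simp]: "normal_goal (GT C)"
  using T_disj.intros(1) by (auto simp: normal_goal_def)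

inductive_cases T_disj_GTE: "T_disj Cs (GT C)"
inductive_cases T_disj_GOrE: "T_disj Cs (GOr E E')"

lemma T_disj_unique: "T_disj Cs E \<Longrightarrow> T_disj Ds E \<Longrightarrow> Cs = Ds"
  by (induction arbitrary: Ds rule: T_disj.induct) (blast elim: T_disj_GTE T_disj_GOrE)+

lemma T_disj_mk_T_disj: "Cs \<noteq> [] \<Longrightarrow> T_disj Cs (mk_T_disj Cs)"
proof (induction Cs rule: mk_T_disj.induct)
  case (3 C D Cs)
  then show ?case using T_disj.intros(2)[OF T_disj.intros(1)] by fastforce
qed (auto intro: T_disj.intros)

lemma normal_mk_T_disj: "normal_goal (mk_T_disj Cs)"
  by (cases "Cs = []") (auto simp: normal_goal_def intro: T_disj_mk_T_disj)

fun normal_rule :: "'a lit_rule \<Rightarrow> bool" where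
  "normal_rule (Program A) \<longleftrightarrow> True"
| "normal_rule (Computed E) \<longleftrightarrow> normal_goal E"

lemma step_GLit:
  assumes "normal_rule (R l)"
  shows "\<exists>E. step R (GLit gs l) E"
proof (cases "loop_literal (gs @ [l])")
  case True
  then show ?thesis unfolding loop_literal_def using step.loop_F step.loop_T by blast
next
  case False
  show ?thesis
  proof (cases "R l")
    case (Program A)
    then show ?thesis using False step.program by blast
  next
    case (Computed E)
    then show ?thesis
      using False assms step.computed_F step.recycling by (fastforce simp: normal_goal_def)
  qed
qed

text \<open>Computed rules are given by irreducible goals; this recovers their shape. A conjunction
  of two disjunctions of contexts always admits distribution or a merge.\<close>

lemma irreducible_normal:
  assumes "\<And>l. normal_rule (R l)"
  shows "\<nexists>E'. step R E E' \<Longrightarrow> normal_goal E"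
proof (induction E)
  case (GLit gs l)
  then show ?case using step_GLit[of R l gs] assms by blast
next
  case (GOr E F)
  then have "normal_goal E" "normal_goal F" by (blast intro: step.intros)+
  moreover have "E \<noteq> GF" "F \<noteq> GF" using GOr.prems by (blast intro: step.intros)+
  ultimately show ?case by (auto simp: normal_goal_def intro: T_disj.intros)
next
  case (GAnd E F)
  then have "normal_goal E" "normal_goal F" by (blast intro: step.intros)+
  moreover have "E \<noteq> GF" "F \<noteq> GF" using GAnd.prems by (blast intro: step.intros)+
  ultimately obtain Cs Ds where "T_disj Cs E" "T_disj Ds F" by (auto simp: normal_goal_def)
  then have "(\<exists>C. E = GT C) \<or> (\<exists>E1 E2. E = GOr E1 E2)" "(\<exists>C. F = GT C) \<or> (\<exists>F1 F2. F = GOr F1 F2)"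
    by (metis T_disj.cases)+
  then have False
    using GAnd.prems step.distrib_left step.distrib_right
      step.T_and_T_consistent step.T_and_T_inconsistent by metis
  then show ?case ..
qed simp_all

section \<open>Existence of normal forms\<close>

abbreviation steps :: "'a system \<Rightarrow> 'a goal \<Rightarrow> 'a goal \<Rightarrow> bool" where
  "steps R \<equiv> (step R)\<^sup>*\<^sup>*"

lemma steps_congs:
  assumes "steps R E E'"
  shows "steps R (GAnd E F) (GAnd E' F)" "steps R (GAnd F E) (GAnd F E')"
    "steps R (GOr E F) (GOr E' F)" "steps R (GOr F E) (GOr F E')"
  using assms
  by (induction rule: rtranclp_induct; auto intro: rtranclp.rtrancl_into_rtrancl step.intros)+

lemma steps_GAnd: "steps R E E' \<Longrightarrow> steps R F F' \<Longrightarrow> steps R (GAnd E F) (GAnd E' F')"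
  by (meson rtranclp_trans steps_congs(1,2))

lemma steps_GOr: "steps R E E' \<Longrightarrow> steps R F F' \<Longrightarrow> steps R (GOr E F) (GOr E' F')"
  by (meson rtranclp_trans steps_congs(3,4))

text \<open>Weak normalization suffices, since completeness asks for the existence of one rewrite
  sequence.\<close>

definition normalizes :: "'a system \<Rightarrow> 'a goal \<Rightarrow> bool" where
  "normalizes R E \<longleftrightarrow> (\<exists>E'. steps R E E' \<and> normal_goal E')"

lemma normal_normalizes: "normal_goal E \<Longrightarrow> normalizes R E"
  unfolding normalizes_def by blast

lemma normalizes_steps: "steps R E E' \<Longrightarrow> normalizes R E' \<Longrightarrow> normalizes R E"
  unfolding normalizes_def by (meson rtranclp_trans)

lemma normalizes_step: "step R E E' \<Longrightarrow> normalizes R E' \<Longrightarrow> normalizes R E"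
  by (blast intro: normalizes_steps)

lemma normalizes_GOr:
  assumes "normalizes R E" "normalizes R F"
  shows "normalizes R (GOr E F)"
proof -
  obtain E' F' where E: "steps R E E'" "normal_goal E'" and F: "steps R F F'" "normal_goal F'"
    using assms unfolding normalizes_def by blast
  have "normalizes R (GOr E' F')"
  proof (cases "E' = GF \<or> F' = GF")
    case True
    then show ?thesis using E(2) F(2) by (metis step.F_or step.or_F normalizes_step normal_normalizes)
  next
    case False
    then show ?thesis using E(2) F(2)
      by (intro normal_normalizes) (auto simp: normal_goal_def intro: T_disj.intros)
  qed
  then show ?thesis using normalizes_steps steps_GOr E(1) F(1) by blast
qed

lemma normalizes_GAnd_GT: "T_disj Ds F \<Longrightarrow> normalizes R (GAnd (GT C) F)"
proof (induction rule: T_disj.induct)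
  case (1 D)
  show ?case
    by (metis normal_GT normal_GF normal_normalizes normalizes_step step.T_and_T_consistent step.T_and_T_inconsistent)
next
  case (2 Cs E Ds E')
  then show ?case by (blast intro: normalizes_step step.distrib_left normalizes_GOr)
qed

lemma normalizes_GAnd_T_disj:
  "T_disj Cs E \<Longrightarrow> T_disj Ds F \<Longrightarrow> normalizes R (GAnd E F)"
proof (induction rule: T_disj.induct)
  case (1 C)
  then show ?case by (rule normalizes_GAnd_GT)
next
  case (2 Cs E Ds E')
  then show ?case by (blast intro: normalizes_step step.distrib_right normalizes_GOr)
qed

lemma normalizes_GAnd:
  assumes "normalizes R E" "normalizes R F"
  shows "normalizes R (GAnd E F)"
proof -
  obtain E' F' where E: "steps R E E'" "normal_goal E'" and F: "steps R F F'" "normal_goal F'"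
    using assms unfolding normalizes_def by blast
  have GF: "normalizes R GF" by (simp add: normal_normalizes)
  have "normalizes R (GAnd E' F')"
    using E(2) F(2) GF normalizes_GAnd_T_disj unfolding normal_goal_def
    by (metis step.F_and step.and_F normalizes_step)
  then show ?thesis using normalizes_steps steps_GAnd E(1) F(1) by blast
qed

lemma normalizes_push:
  assumes "\<And>a. a \<in> set_form A \<Longrightarrow> normalizes R (GLit ch (Pos a)) \<and> normalizes R (GLit ch (Neg a))"
  shows "normalizes R (push b ch A)"
  using assms
proof (induction A arbitrary: b)
  case (FAnd A B)
  then have "normalizes R (push b ch A)" "normalizes R (push b ch B)" by simp_all
  then show ?case by (auto intro: normalizes_GAnd normalizes_GOr)
next
  case (FOr A B)
  then have "normalizes R (push b ch A)" "normalizes R (push b ch B)" by simp_all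
  then show ?case by (auto intro: normalizes_GAnd normalizes_GOr)
qed (auto intro: normal_normalizes)

text \<open>
  Chains of non-loop literals have no repetitions, so their lengths are bounded when only finitely
  many literals are available.
\<close>

lemma normalizes_GLit:
  assumes fin: "finite U" and normal: "\<And>l. normal_rule (R l)"
    and closed: "\<And>l A. R l = Program A \<Longrightarrow> Pos ` set_form A \<union> Neg ` set_form A \<subseteq> U"
  shows "l \<in> U \<Longrightarrow> normalizes R (GLit gs l)"
proof (induction "card (U - set gs)" arbitrary: gs l rule: less_induct)
  case less
  show ?case
  proof (cases "loop_literal (gs @ [l])")
    case True
    then show ?thesis
      unfolding loop_literal_def
      by (metis normal_GT normal_GF normal_normalizes normalizes_step step.loop_F step.loop_T)
  next
    case False
    show ?thesis
    proof (cases "R l")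
      case (Program A)
      have "l \<notin> set gs" using False by (simp add: loop_literal_snoc_iff)
      then have "card (U - set (gs @ [l])) < card (U - set gs)"
        using less.prems fin by (intro psubset_card_mono) auto
      then have "normalizes R (GLit (gs @ [l]) m)" if "m \<in> U" for m
        using less.hyps that by blast
      then have "normalizes R (push True (gs @ [l]) A)"
        using closed[OF Program] by (intro normalizes_push) blast
      then show ?thesis using normalizes_step step.program[of R l A "gs @ [l]" gs] Program False by blast
    next
      case (Computed E)
      then have "normal_goal E" using normal[of l] by simp
      then consider "E = GF" | Ds where "T_disj Ds E" unfolding normal_goal_def by blast
      then show ?thesis
      proof cases
        case 1
        then show ?thesis
          using Computed False by (metis normal_GF normal_normalizes normalizes_step step.computed_F)
      next
        case 2
        show ?thesis
          by (rule normalizes_step[OF step.recycling[of R l E Ds "gs @ [l]"]])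
            (use Computed 2 False in \<open>simp_all add: normal_normalizes normal_mk_T_disj\<close>)
      qed
    qed
  qed
qed


section \<open>Soundness of rewriting\<close>

text \<open>
  In \<open>expand\<close> the pairs in \<open>X\<close> are the selected children with their contexts. A relation
  is needed since two occurrences of the same child may be given different contexts.
\<close>

inductive justified :: "'a program \<Rightarrow> 'a system \<Rightarrow> 'a lit list \<Rightarrow> 'a lit \<Rightarrow> 'a lit set \<Rightarrow> bool"
  for P R where
  loop: "success_loop_literal (gs @ [l]) \<Longrightarrow> justified P R gs l (set (gs @ [l]))"
| recycle: "R l = Computed E \<Longrightarrow> T_disj Ds E \<Longrightarrow> D \<in> set Ds \<Longrightarrow> consistent (D \<union> set (gs @ [l])) \<Longrightarrow>
    justified P R gs l (set (gs @ [l]) \<union> D)"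
| expand: "supported P l (fst ` X) \<Longrightarrow>
    (\<And>m C. (m, C) \<in> X \<Longrightarrow> justified P R (gs @ [l]) m C) \<Longrightarrow>
    (consistent (set gs) \<Longrightarrow> consistent (set (gs @ [l]) \<union> \<Union> (snd ` X))) \<Longrightarrow>
    justified P R gs l (set (gs @ [l]) \<union> \<Union> (snd ` X))"

lemma justified_chain: "justified P R gs l C \<Longrightarrow> set (gs @ [l]) \<subseteq> C"
  by (induction rule: justified.induct) auto

text \<open>A loop leaf repeats a literal of its chain and so adds nothing; in the other cases
  consistency is built into the rules.\<close>

lemma justified_consistent: "justified P R gs l C \<Longrightarrow> consistent (set gs) \<Longrightarrow> consistent C"
proof (induction rule: justified.induct)
  case (loop gs l)
  then have "set (gs @ [l]) = set gs" using success_loop_literal_mem by fastforce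
  then show ?case using loop by simp
qed (simp_all add: Un_commute)

text \<open>The contexts a goal may still contribute. An unexpanded occurrence offers those of all
  its proof trees; a conjunction keeps the consistent unions, as the simplification rules
  do.\<close>

primrec context_of :: "'a program \<Rightarrow> 'a system \<Rightarrow> 'a goal \<Rightarrow> 'a lit set \<Rightarrow> bool" where
  "context_of P R (GLit gs l) C \<longleftrightarrow> justified P R gs l C"
| "context_of P R GF C \<longleftrightarrow> False"
| "context_of P R (GT D) C \<longleftrightarrow> C = D"
| "context_of P R (GAnd E F) C \<longleftrightarrow>
     (\<exists>C1 C2. context_of P R E C1 \<and> context_of P R F C2 \<and> C = C1 \<union> C2 \<and> consistent C)"
| "context_of P R (GOr E F) C \<longleftrightarrow> context_of P R E C \<or> context_of P R F C"

lemma context_of_T_disj: "T_disj Cs E \<Longrightarrow> context_of P R E C \<longleftrightarrow> C \<in> set Cs"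
  by (induction rule: T_disj.induct) auto

lemma context_of_mk_T_disj: "context_of P R (mk_T_disj Cs) C \<longleftrightarrow> C \<in> set Cs"
  by (cases "Cs = []") (simp_all add: context_of_T_disj[OF T_disj_mk_T_disj])

lemma context_of_push_consistent:
  "context_of P R (push b ch A) C \<Longrightarrow> consistent (set ch) \<Longrightarrow> consistent C"
  by (induction A arbitrary: b C) (auto split: if_splits intro: justified_consistent)

lemma holds_mono: "holds b K A \<Longrightarrow> K \<subseteq> K' \<Longrightarrow> holds b K' A"
  by (induction A arbitrary: b) (auto split: if_splits)

text \<open>\<open>X\<close> collects the chosen literal occurrences of the formula with their
  contexts: one side where \<open>push\<close> gives a disjunction, both sides where it gives a
  conjunction.\<close>

lemma context_of_push:
  "context_of P R (push b ch A) C \<Longrightarrow>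
   \<exists>X. holds b (fst ` X) A \<and> (\<forall>(m, C')\<in>X. justified P R ch m C') \<and> C = set ch \<union> \<Union> (snd ` X)"
proof (induction A arbitrary: b C)
  case (FAtom a)
  then show ?case using justified_chain[of P R ch _ C]
    by (intro exI[of _ "{(if b then Pos a else Neg a, C)}"]) auto
next
  case FTrue
  then show ?case by (intro exI[of _ "{}"]) (auto split: if_splits)
next
  case FFalse
  then show ?case by (intro exI[of _ "{}"]) (auto split: if_splits)
next
  case (FNot A)
  then show ?case by simp
next
  case (FAnd A B)
  show ?case
  proof (cases b)
    case True
    then obtain C1 C2 where C: "context_of P R (push b ch A) C1" "context_of P R (push b ch B) C2"
      "C = C1 \<union> C2" using FAnd.prems by auto
    from FAnd.IH(1)[OF C(1)] FAnd.IH(2)[OF C(2)] obtain X Y where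
      X: "holds b (fst ` X) A" "\<forall>(m, C')\<in>X. justified P R ch m C'" "C1 = set ch \<union> \<Union> (snd ` X)" and
      Y: "holds b (fst ` Y) B" "\<forall>(m, C')\<in>Y. justified P R ch m C'" "C2 = set ch \<union> \<Union> (snd ` Y)"
      by blast
    show ?thesis
      by (intro exI[of _ "X \<union> Y"])
        (use True X Y C(3) in \<open>auto intro: holds_mono simp: image_Un\<close>)
  next
    case False
    then show ?thesis using FAnd.IH[of b C] FAnd.prems by auto
  qed
next
  case (FOr A B)
  show ?case
  proof (cases b)
    case False
    then obtain C1 C2 where C: "context_of P R (push b ch A) C1" "context_of P R (push b ch B) C2"
      "C = C1 \<union> C2" using FOr.prems by auto
    from FOr.IH(1)[OF C(1)] FOr.IH(2)[OF C(2)] obtain X Y where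
      X: "holds b (fst ` X) A" "\<forall>(m, C')\<in>X. justified P R ch m C'" "C1 = set ch \<union> \<Union> (snd ` X)" and
      Y: "holds b (fst ` Y) B" "\<forall>(m, C')\<in>Y. justified P R ch m C'" "C2 = set ch \<union> \<Union> (snd ` Y)"
      by blast
    show ?thesis
      by (intro exI[of _ "X \<union> Y"])
        (use False X Y C(3) in \<open>auto intro: holds_mono simp: image_Un\<close>)
  next
    case True
    then show ?thesis using FOr.IH[of b C] FOr.prems by auto
  qed
qed

lemma consistent_snoc:
  assumes "\<not> loop_literal (gs @ [l])" "consistent (set gs)"
  shows "consistent (set (gs @ [l]))"
proof -
  have "compl l \<notin> set gs" using assms(1) by (simp add: loop_literal_snoc_iff)
  moreover have "compl l \<noteq> l" by (cases l) auto
  moreover have "compl m \<noteq> l" if "m \<in> set gs" for m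
    using that \<open>compl l \<notin> set gs\<close> by (metis compl_compl)
  ultimately show ?thesis using assms(2) by (auto simp: consistent_def)
qed

definition programs_define :: "'a program \<Rightarrow> 'a system \<Rightarrow> bool" where
  "programs_define P R \<longleftrightarrow> (\<forall>l A. R l = Program A \<longrightarrow> defining P l A)"

lemma programs_define_holds:
  "programs_define P R \<Longrightarrow> R l = Program A \<Longrightarrow> holds True K A \<longleftrightarrow> supported P l K"
  by (simp add: programs_define_def defining_def)

text \<open>Contexts are preserved backwards, so a context of a final goal traces back to a proof
  tree of the initial literal.\<close>

lemma context_of_step:
  assumes "programs_define P R"
  shows "step R E E' \<Longrightarrow> context_of P R E' C \<Longrightarrow> context_of P R E C"
proof (induction arbitrary: C rule: step.induct)
  case (program l A ch gs)
  from context_of_push[OF program.prems] obtain X where X: "holds True (fst ` X) A"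
    "\<forall>(m, C')\<in>X. justified P R ch m C'" "C = set ch \<union> \<Union> (snd ` X)" by (elim exE conjE)
  have "supported P l (fst ` X)" using programs_define_holds[OF assms program.hyps(1)] X(1) by simp
  \<comment> \<open>The step may occur in an arbitrary goal, where the chain need not be consistent;
    the condition is discharged later at the empty chain.\<close>
  moreover have "consistent C" if "consistent (set gs)"
  proof (rule context_of_push_consistent[OF program.prems])
    show "consistent (set ch)"
      using consistent_snoc[of gs l] that program.hyps(2,3) by simp
  qed
  ultimately have "justified P R gs l (set (gs @ [l]) \<union> \<Union> (snd ` X))"
    using X(2,3) program.hyps(2) by (intro justified.expand) auto
  then show ?case using X(3) program.hyps(2) by simp
next
  case (recycling l E Ds ch gs)
  then show ?case by (auto simp: context_of_mk_T_disj simp del: set_append intro: justified.recycle)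
next
  case (loop_T ch gs l)
  then show ?case using justified.loop by auto
next
  case (T_and_T_inconsistent C1 C2)
  then show ?case by simp
qed (simp_all, blast+)

lemma context_of_steps:
  assumes "programs_define P R"
  shows "steps R E E' \<Longrightarrow> context_of P R E' C \<Longrightarrow> context_of P R E C"
proof (induction rule: rtranclp_induct)
  case (step E' E'')
  then show ?case using context_of_step[OF assms] by blast
qed

section \<open>Admissibility of the contexts\<close>

definition computed_admissible :: "'a program \<Rightarrow> 'a system \<Rightarrow> bool" where
  "computed_admissible P R \<longleftrightarrow>
     (\<forall>l E Ds. R l = Computed E \<longrightarrow> T_disj Ds E \<longrightarrow> (\<forall>D\<in>set Ds. admissible P D \<and> l \<in> D))"

lemma computed_admissibleD:
  "computed_admissible P R \<Longrightarrow> R l = Computed E \<Longrightarrow> T_disj Ds E \<Longrightarrow> D \<in> set Ds \<Longrightarrow>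
    admissible P D \<and> l \<in> D"
  by (auto simp: computed_admissible_def)

text \<open>Literals on \<open>gs\<close> are exempt because their support comes from nodes higher
  in the proof tree; at the root there are none.\<close>

lemma justified_supported:
  assumes "computed_admissible P R"
  shows "justified P R gs l C \<Longrightarrow> m \<in> C \<Longrightarrow> m \<notin> set gs \<Longrightarrow> supported P m C"
proof (induction arbitrary: m rule: justified.induct)
  case (loop gs l)
  then show ?case using success_loop_literal_mem by fastforce
next
  case (recycle l E Ds D gs)
  then have "supported P m D" using computed_admissibleD[OF assms recycle(1-3)] by (auto simp: admissible_def)
  then show ?case by (rule supported_mono) auto
next
  case (expand l X gs)
  show ?case
  proof (cases "m = l")
    case True
    have "fst ` X \<subseteq> \<Union> (snd ` X)" using expand.hyps(2) justified_chain by fastforce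
    then show ?thesis unfolding True by (intro supported_mono[OF expand.hyps(1)]) blast
  next
    case False
    then obtain m' C' where "(m', C') \<in> X" "m \<in> C'" using expand.prems by auto
    then have "supported P m C'" using expand.IH[of m' C' m] False expand.prems by simp
    then show ?thesis by (rule supported_mono) (use \<open>(m', C') \<in> X\<close> in force)
  qed
qed

text \<open>
  A positive leaf closed by an even loop repeats an atom from above the last negative literal of
  its chain, so a positive literal depends, apart from negative literals, only on such atoms.
\<close>

lemma justified_derivable_root:
  assumes "computed_admissible P R"
  shows "justified P R gs l C \<Longrightarrow> l = Pos a \<Longrightarrow>
    derivable P (nafs C \<union> Atm ` pos_before_neg gs) (Atm a)"
proof (induction arbitrary: a rule: justified.induct)
  case (loop gs l)
  then have "a \<in> pos_before_neg gs" by (intro success_loop_literal_Pos) simp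
  then show ?case by (intro derivable.assm) simp
next
  case (recycle l E Ds D gs)
  then have "derivable P (nafs D) (Atm a)" using computed_admissibleD[OF assms recycle(1-3)] by (auto simp: admissible_def)
  then show ?case by (rule derivable_mono) (auto simp: nafs_def)
next
  case (expand l X gs)
  let ?C = "set (gs @ [l]) \<union> \<Union> (snd ` X)"
  let ?S = "nafs ?C \<union> Atm ` pos_before_neg gs"
  obtain r where r: "r \<in> P" "head r = a" "body_lits r \<subseteq> fst ` X"
    using expand.hyps(1) expand.prems by auto
  have "derivable P ?S x" if "x \<in> body_natoms r" for x
  proof (cases x)
    case (Atm b)
    then have "Pos b \<in> fst ` X" using that r(3) by (auto simp: body_lits_def body_natoms_def)
    then obtain C' where C': "(Pos b, C') \<in> X" by auto
    have "derivable P (nafs C' \<union> Atm ` pos_before_neg (gs @ [l])) (Atm b)"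
      using expand.IH[OF C'] by blast
    moreover have "nafs C' \<subseteq> nafs ?C" using C' by (intro nafs_mono) force
    moreover have "pos_before_neg (gs @ [l]) \<subseteq> pos_before_neg gs"
      using pos_before_neg_snoc_Pos[of gs a] expand.prems by simp
    ultimately show ?thesis unfolding Atm by (elim derivable_mono) blast
  next
    case (Naf b)
    then have "Neg b \<in> fst ` X" using that r(3) by (auto simp: body_lits_def body_natoms_def)
    then obtain C' where C': "(Neg b, C') \<in> X" by auto
    then have "Neg b \<in> C'" using justified_chain[OF expand.hyps(2)[OF C']] by simp
    then show ?thesis using C' Naf by (intro derivable.assm) force
  qed
  then show ?case using derivable.rule[OF r(1), of ?S] r(2) by simp
qed

text \<open>Chain atoms serve as temporary assumptions. Passing from a child to its parent removes
  the assumption \<open>l\<close>, whose derivability is \<open>justified_derivable_root\<close>; at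
  the root none is left.\<close>

lemma justified_derivable:
  assumes "computed_admissible P R"
  shows "justified P R gs l C \<Longrightarrow> Pos a \<in> C \<Longrightarrow>
    derivable P (nafs C \<union> {Atm b | b. Pos b \<in> set gs}) (Atm a)"
proof (induction arbitrary: a rule: justified.induct)
  case (loop gs l)
  then show ?case using success_loop_literal_mem[of gs l] by (intro derivable.assm) auto
next
  case (recycle l E Ds D gs)
  show ?case
  proof (cases "Pos a \<in> set gs")
    case True
    then show ?thesis by (intro derivable.assm) simp
  next
    case False
    then have "Pos a \<in> D" using recycle computed_admissibleD[OF assms recycle(1-3)] by auto
    then have "derivable P (nafs D) (Atm a)"
      using computed_admissibleD[OF assms recycle(1-3)] by (auto simp: admissible_def)
    then show ?thesis by (rule derivable_mono) (auto simp: nafs_def)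
  qed
next
  case (expand l X gs)
  let ?C = "set (gs @ [l]) \<union> \<Union> (snd ` X)"
  let ?S = "nafs ?C \<union> {Atm b | b. Pos b \<in> set gs}"
  have chain: "derivable P ?S (Atm b)" if "Pos b \<in> set (gs @ [l])" for b
  proof (cases "Pos b = l")
    case True
    have "justified P R gs l ?C" using expand.hyps by (rule justified.expand)
    then have "derivable P (nafs ?C \<union> Atm ` pos_before_neg gs) (Atm b)"
      using True justified_derivable_root[OF assms] by blast
    then show ?thesis by (rule derivable_mono) (auto dest: pos_before_neg_subset)
  next
    case False
    then show ?thesis using that by (intro derivable.assm) auto
  qed
  show ?case
  proof (cases "Pos a \<in> set (gs @ [l])")
    case True
    then show ?thesis by (rule chain)
  next
    case False
    then obtain m C' where C': "(m, C') \<in> X" "Pos a \<in> C'" using expand.prems by auto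
    then have "derivable P (nafs C' \<union> {Atm b | b. Pos b \<in> set (gs @ [l])}) (Atm a)"
      by (rule expand.IH)
    then show ?thesis
    \<comment> \<open>The only assumption of the child that may be new is \<open>l\<close> itself,
      and \<open>chain\<close> derives it.\<close>
    proof (rule derivable_cut)
      fix y assume "y \<in> nafs C' \<union> {Atm b | b. Pos b \<in> set (gs @ [l])}"
      moreover have "nafs C' \<subseteq> nafs ?C" using C'(1) by (intro nafs_mono) force
      ultimately show "derivable P ?S y" using chain by (blast intro: derivable.assm)
    qed
  qed
qed

lemma justified_admissible:
  assumes "computed_admissible P R" and "justified P R [] l C"
  shows "admissible P C \<and> l \<in> C"
proof -
  have "consistent C" using justified_consistent[OF assms(2)] by (simp add: consistent_def)
  moreover have "supported P m C" if "m \<in> C" for m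
    using justified_supported[OF assms that] by simp
  moreover have "derivable P (nafs C) (Atm a)" if "Pos a \<in> C" for a
    using justified_derivable[OF assms that] by simp
  ultimately show ?thesis using justified_chain[OF assms(2)] by (simp add: admissible_def)
qed


section \<open>Completeness of rewriting\<close>

text \<open>Ranks are compared only between adjacent atoms: a negative literal on the chain resets
  the comparison.\<close>

fun pos_decreasing :: "('a \<Rightarrow> nat) \<Rightarrow> 'a lit \<Rightarrow> 'a lit \<Rightarrow> bool" where
  "pos_decreasing rk (Pos a) (Pos b) \<longleftrightarrow> rk b < rk a"
| "pos_decreasing rk _ _ \<longleftrightarrow> True"

text \<open>An occurrence carries a condition on its whole chain: lying in \<open>M\<close> rules
  out odd loops, and decreasing ranks rule out positive ones.\<close>

primrec true_goal :: "'a lit set \<Rightarrow> ('a \<Rightarrow> nat) \<Rightarrow> 'a goal \<Rightarrow> bool" where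
  "true_goal M rk (GLit gs l) \<longleftrightarrow>
     set (gs @ [l]) \<subseteq> M \<and> successively (pos_decreasing rk) (gs @ [l])"
| "true_goal M rk GF \<longleftrightarrow> False"
| "true_goal M rk (GT C) \<longleftrightarrow> C \<subseteq> M"
| "true_goal M rk (GAnd E F) \<longleftrightarrow> true_goal M rk E \<and> true_goal M rk F"
| "true_goal M rk (GOr E F) \<longleftrightarrow> true_goal M rk E \<or> true_goal M rk F"

lemma true_goal_T_disj: "T_disj Cs E \<Longrightarrow> true_goal M rk E \<longleftrightarrow> (\<exists>C\<in>set Cs. C \<subseteq> M)"
  by (induction rule: T_disj.induct) auto

lemma true_goal_mk_T_disj: "true_goal M rk (mk_T_disj Cs) \<longleftrightarrow> (\<exists>C\<in>set Cs. C \<subseteq> M)"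
  by (cases "Cs = []") (simp_all add: true_goal_T_disj[OF T_disj_mk_T_disj])

lemma true_goal_push:
  assumes "set ch \<subseteq> M" and "\<And>m. m \<in> K \<Longrightarrow> true_goal M rk (GLit ch m)"
  shows "holds b K A \<Longrightarrow> true_goal M rk (push b ch A)"
  using assms by (induction A arbitrary: b) (auto split: if_splits simp del: true_goal.simps(1))

lemma not_positive_loop:
  assumes "successively (pos_decreasing rk) ls"
  shows "\<not> positive_loop ls"
proof
  assume "positive_loop ls"
  then have ls: "length ls \<ge> 2" "hd ls = last ls" "set ls \<subseteq> range Pos"
    by (auto simp: positive_loop_def)
  \<comment> \<open>A positive loop consists of atoms, so the value 0 is a mere default.\<close>
  define f where "f l = (case l of Pos a \<Rightarrow> rk a | Neg a \<Rightarrow> 0)" for l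
  have "successively (\<lambda>l m. f m < f l) ls"
    using assms
  proof (rule successively_mono)
    fix l m assume "l \<in> set ls" "m \<in> set ls" "pos_decreasing rk l m"
    moreover from this ls(3) obtain a b where "l = Pos a" "m = Pos b" by blast
    ultimately show "f m < f l" by (simp add: f_def)
  qed
  then have "sorted_wrt (\<lambda>l m. f m < f l) ls"
    by (subst (asm) successively_conv_sorted_wrt) (auto intro!: transpI)
  moreover obtain x y zs where "ls = x # y # zs"
    using ls(1) by (cases ls rule: remdups_adj.cases) auto
  ultimately have "f (last ls) < f (hd ls)" by simp
  then show False using ls(2) by simp
qed

lemma successively_drop: "successively Q ls \<Longrightarrow> successively Q (drop k ls)"
  by (metis append_take_drop_id successively_append_iff)

text \<open>Truth survives every step, not just suitably chosen ones, so whichever normal form is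
  reached has a disjunct inside \<open>M\<close>.\<close>

lemma true_goal_step:
  assumes model: "partial_stable_model P M"
    and prog: "programs_define P R"
    and comp: "\<And>l E. R l = Computed E \<Longrightarrow> l \<in> M \<Longrightarrow> \<exists>Ds. T_disj Ds E \<and> (\<exists>D\<in>set Ds. D \<subseteq> M)"
    and rk: "\<And>a. Pos a \<in> M \<Longrightarrow>
       \<exists>r\<in>P. head r = a \<and> body_lits r \<subseteq> M \<and> (\<forall>b\<in>set (pos_body r). rk b < rk a)"
  shows "step R E E' \<Longrightarrow> true_goal M rk E \<Longrightarrow> true_goal M rk E'"
proof (induction rule: step.induct)
  case (program l A ch gs)
  then have ch: "set ch \<subseteq> M" "l \<in> M" "successively (pos_decreasing rk) ch" "ch \<noteq> []" "last ch = l"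
    by auto
  have child: "true_goal M rk (GLit ch m)" if "m \<in> M" "pos_decreasing rk l m" for m
    using ch that by (simp add: successively_append_iff)
  \<comment> \<open>The children that keep the chain condition. For an atom the ranked rule lies
    within \<open>K\<close>; for a negative literal \<open>K\<close> is all of
    \<open>M\<close>.\<close>
  define K where "K = {m \<in> M. pos_decreasing rk l m}"
  have "supported P l K"
  proof (cases l)
    case (Pos a)
    with rk[of a] ch(2) obtain r where "r \<in> P" "head r = a" "body_lits r \<subseteq> M"
      "\<forall>b\<in>set (pos_body r). rk b < rk a" by blast
    then show ?thesis unfolding Pos by (auto simp: K_def Pos body_lits_def intro!: bexI[of _ r])
  next
    case (Neg a)
    then have "K = M" by (simp add: K_def)
    then show ?thesis using partial_stable_model_Neg_supported[OF model] ch(2) Neg by simp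
  qed
  then have "holds True K A" using programs_define_holds[OF prog program.hyps(1)] by simp
  moreover have "true_goal M rk (GLit ch m)" if "m \<in> K" for m
    by (rule child) (use that in \<open>simp_all add: K_def\<close>)
  ultimately show ?case using true_goal_push[OF ch(1)] by blast
next
  case (computed_F l gs)
  then show ?case using comp[of l GF] by (auto elim: T_disj.cases)
next
  case (recycling l E Ds ch gs)
  then have ch: "set ch \<subseteq> M" "l \<in> M" by auto
  obtain D where D: "D \<in> set Ds" "D \<subseteq> M"
    using comp[OF recycling.hyps(1) ch(2)] T_disj_unique[OF recycling.hyps(2)] by blast
  \<comment> \<open>Both sets lie in \<open>M\<close>, so \<open>D\<close> survives the consistency
    filter of recycling.\<close>
  have "consistent (D \<union> set ch)"
    using D(2) ch(1) partial_stable_model_consistent[OF model] by (auto elim: consistent_mono)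
  then show ?case using D ch(1) by (auto simp: true_goal_mk_T_disj)
next
  case (loop_F gs l)
  then obtain k where k: "positive_loop (drop k (gs @ [l])) \<or> odd_loop (drop k (gs @ [l]))"
    by (auto simp: fail_loop_literal_def)
  have sub: "set (drop k (gs @ [l])) \<subseteq> M"
    using loop_F.prems set_drop_subset[of k "gs @ [l]"] by simp blast
  have "\<not> positive_loop (drop k (gs @ [l]))"
    using loop_F.prems by (intro not_positive_loop[of rk] successively_drop) simp
  then have odd: "odd_loop (drop k (gs @ [l]))" using k by blast
  then have "drop k (gs @ [l]) \<noteq> []" by (auto simp: odd_loop_def)
  then have "hd (drop k (gs @ [l])) \<in> M" "last (drop k (gs @ [l])) \<in> M"
    using sub hd_in_set last_in_set by blast+
  then have False
    using odd partial_stable_model_consistent[OF model] by (auto simp: odd_loop_def consistent_def)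
  then show ?case ..
next
  case (T_and_T_inconsistent C1 C2)
  then have "consistent (C1 \<union> C2)"
    by (intro consistent_mono[OF partial_stable_model_consistent[OF model]]) simp
  then show ?case using T_and_T_inconsistent by blast
qed auto


section \<open>The series of systems\<close>

text \<open>The invariant of the series. Recycled contexts are required to be admissible, not just
  contained in a model, because support and derivability inside \<open>D\<close> are reused in
  larger proof trees.\<close>

fun exact_rule :: "'a program \<Rightarrow> 'a lit \<Rightarrow> 'a lit_rule \<Rightarrow> bool" where
  "exact_rule P l (Program A) \<longleftrightarrow> defining P l A"
| "exact_rule P l (Computed E) \<longleftrightarrow> normal_goal E \<and>
     (\<forall>Ds D. T_disj Ds E \<longrightarrow> D \<in> set Ds \<longrightarrow> admissible P D \<and> l \<in> D) \<and>
     (\<forall>M. partial_stable_model P M \<longrightarrow> l \<in> M \<longrightarrow> (\<exists>Ds. T_disj Ds E \<and> (\<exists>D\<in>set Ds. D \<subseteq> M)))"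

lemma exact_rule_normal: "exact_rule P l rl \<Longrightarrow> normal_rule rl"
  by (cases rl) auto

text \<open>Each context traces back to the initial occurrence, whose chain is empty.\<close>

lemma exact_contexts_admissible:
  assumes "\<And>l. exact_rule P l (R l)" "rewrites_to R g E" "T_disj Cs E" "C \<in> set Cs"
  shows "admissible P C \<and> g \<in> C"
proof -
  have prog: "programs_define P R"
    unfolding programs_define_def using assms(1) exact_rule.simps(1) by metis
  have comp: "computed_admissible P R"
    unfolding computed_admissible_def using assms(1) exact_rule.simps(2) by metis
  have "context_of P R E C" using assms(3,4) by (simp add: context_of_T_disj)
  then have "justified P R [] g C"
    using context_of_steps[OF prog assms(2)[unfolded rewrites_to_def]] by simp
  then show ?thesis by (rule justified_admissible[OF comp])
qed

text \<open>The rank depends on the model but the rewriting does not, so one normal form serves all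
  models.\<close>

lemma exact_normal_form_complete:
  assumes "\<And>l. exact_rule P l (R l)" "rewrites_to R g E" "normal_goal E"
    and model: "partial_stable_model P M" "g \<in> M"
  shows "\<exists>Cs. T_disj Cs E \<and> (\<exists>C\<in>set Cs. C \<subseteq> M)"
proof -
  obtain rk :: "'a \<Rightarrow> nat" where rk: "\<And>a. Pos a \<in> M \<Longrightarrow>
       \<exists>r\<in>P. head r = a \<and> body_lits r \<subseteq> M \<and> (\<forall>b\<in>set (pos_body r). rk b < rk a)"
    using partial_stable_model_ranked[OF model(1)] by blast
  have prog: "programs_define P R"
    unfolding programs_define_def using assms(1) exact_rule.simps(1) by metis
  have comp: "\<exists>Ds. T_disj Ds E \<and> (\<exists>D\<in>set Ds. D \<subseteq> M)" if "R l = Computed E" "l \<in> M" for l E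
    using assms(1)[of l] that model(1) by simp
  have true_step: "true_goal M rk E2" if "step R E1 E2" "true_goal M rk E1" for E1 E2
    by (rule true_goal_step[OF model(1) prog _ _ that]) (fact comp rk)+
  have "steps R (GLit [] g) E" using assms(2) by (simp add: rewrites_to_def)
  then have "true_goal M rk E"
    by (induction rule: rtranclp_induct) (use model(2) true_step in auto)
  then show ?thesis using assms(3) by (auto simp: normal_goal_def true_goal_T_disj)
qed

lemma exact_rule_series:
  assumes "system_series P L R"
  shows "exact_rule P l (R i l)"
proof (induction i arbitrary: l)
  case 0
  obtain D where "completion P D" "R 0 = initial_system D"
    using assms unfolding system_series_def by blast
  then show ?case by (metis initial_system_defining exact_rule.simps(1))
next
  case (Suc i)
  have rec: "recycled_system (R i) (L i) (R (Suc i))"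
    using assms by (simp add: system_series_def)
  show ?case
  proof (cases "l \<in> L i")
    case False
    then show ?thesis using rec Suc by (simp add: recycled_system_def)
  next
    case True
    then have "\<exists>E. computed_rule (R i) l E \<and> R (Suc i) l = Computed E"
      using rec[unfolded recycled_system_def, rule_format, of l] by simp
    then obtain E where E: "rewrites_to (R i) l E" "\<nexists>E'. step (R i) E E'" "R (Suc i) l = Computed E"
      unfolding computed_rule_def by blast
    have "normal_goal E" using irreducible_normal[OF exact_rule_normal[OF Suc] E(2)] .
    then show ?thesis
      using exact_contexts_admissible[OF Suc E(1)] exact_normal_form_complete[OF Suc E(1)] E(3)
      by auto
  qed
qed

lemma exact_sound:
  assumes "\<And>l. exact_rule P l (R l)"
  shows "sound P R"
  unfolding sound_def
  using exact_contexts_admissible[OF assms] admissible_extends_to_partial_stable_model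
  by (meson nth_mem)

lemma exact_complete:
  assumes "finite P" and exact: "\<And>l. exact_rule P l (R l)"
  shows "complete P R"
  unfolding complete_def
proof (intro allI impI, elim conjE)
  fix g M assume M: "partial_stable_model P M" "g \<in> M"
  \<comment> \<open>All descendants of \<open>g\<close> are literals over body atoms, while
    \<open>g\<close> itself may not be; finiteness of \<open>P\<close> makes \<open>U\<close> finite
    even over an infinite language.\<close>
  define U where "U = insert g (Pos ` atoms P \<union> Neg ` atoms P)"
  have "finite U" using assms(1) by (simp add: U_def finite_atoms)
  moreover have "Pos ` set_form A \<union> Neg ` set_form A \<subseteq> U" if "R l = Program A" for l A
    using exact[of l] that by (auto simp: U_def defining_def)
  ultimately have "normalizes R (GLit [] g)"
    by (rule normalizes_GLit[OF _ exact_rule_normal[OF exact]]) (simp_all add: U_def)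
  then obtain E where E: "rewrites_to R g E" "normal_goal E"
    by (auto simp: normalizes_def rewrites_to_def)
  then obtain Cs C where C: "T_disj Cs E" "C \<in> set Cs" "C \<subseteq> M"
    using exact_normal_form_complete[OF exact] M by blast
  moreover have "g \<in> C" using exact_contexts_admissible[OF exact E(1) C(1,2)] by simp
  ultimately show "\<exists>E Cs. rewrites_to R g E \<and> T_disj Cs E \<and> (\<exists>j<length Cs. g \<in> Cs ! j \<and> Cs ! j \<subseteq> M)"
    using E(1) by (metis in_set_conv_nth)
qed

theorem theorem4p7:
  fixes P :: "'a program" and L :: "nat \<Rightarrow> 'a lit set" and R :: "nat \<Rightarrow> 'a system" and i :: nat
  assumes "finite P"
    and "system_series P L R"
  shows "sound P (R i) \<and> complete P (R i)"
  using exact_sound exact_complete[OF assms(1)] exact_rule_series[OF assms(2)] by blast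

end
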